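(* Let $w:\mathbb{Z}^+\to\mathbb{R}_{\ge 0}$ be a sequence of non-negative weights, and suppose the series $\gamma_w=\sum_{t=1}^\infty w(t)\,q_t$ converges. Let $F_w(n)=\sum_{t=1}^\infty w(t)\,c_t(n)$. Then, as $n\to\infty$: (1) $F_w(n)=(\gamma_w-o(1))\,2^n$; (2) $S_w(n):=\sum_{m=1}^{n-1}F_w(m)=(\gamma_w-o(1))\,2^n$; (3) $(F_w*F_w)(n):=\sum_{m=1}^{n-1}F_w(m)F_w(n-m)=(\gamma_w^2-o(1))\,n\,2^n$, where $o(1)$ denotes a quantity tending to $0$ as $n\to\infty$.
   Context: For integers $t\ge1$, $n\ge1$, $$c_t(n)=\sum_{\substack{p_1>\cdots>p_t\ge1\\ p_1+\cdots+p_t=n}}\frac{1}{t(t+1)}\prod_{i=1}^t\Big(\frac{i+1}{i}\Big)^{p_i}$$ (an empty sum is $0$). The sequence $q_t$ is defined by $q_1=1/2$ and $q_t=\frac{t-1}{2^t-t-1}q_{t-1}$ for $t\ge2$, i.e. $q_t=\frac12\prod_{i=2}^t\frac{i-1}{2^i-i-1}$. *)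

theory Defs
  imports Complex_Main
begin

text \<open>
  Index tuples \<open>p\<^sub>1 > \<dots> > p\<^sub>t \<ge> 1\<close> with \<open>p\<^sub>1 + \<dots> + p\<^sub>t = n\<close>, as lists of length \<open>t\<close>;
  \<open>p\<^sub>i\<close> is \<open>p ! (i - 1)\<close>.
\<close>
definition distinct_parts :: "nat \<Rightarrow> nat \<Rightarrow> nat list set" where
  "distinct_parts t n =
     {p. length p = t \<and> sorted_wrt (>) p \<and> (\<forall>x\<in>set p. x \<ge> 1) \<and> sum_list p = n}"

text \<open>Sums over infinite sets are \<open>0\<close> by convention; this does not interfere here.\<close>
lemma finite_distinct_parts: "finite (distinct_parts t n)"
proof (rule finite_subset)
  show "distinct_parts t n \<subseteq> {p. set p \<subseteq> {..n} \<and> length p = t}"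
    by (auto simp: distinct_parts_def intro: member_le_sum_list)
  show "finite {p. set p \<subseteq> {..n} \<and> length p = t}"
    by (rule finite_lists_length_eq) simp
qed

definition c_coeff :: "nat \<Rightarrow> nat \<Rightarrow> real" where
  "c_coeff t n = (\<Sum>p\<in>distinct_parts t n.
     1 / (real t * (real t + 1)) * (\<Prod>i=1..t. ((real i + 1) / real i) ^ (p ! (i - 1))))"

text \<open>The sequence starts at index \<open>1\<close>; the value at \<open>0\<close> is irrelevant.\<close>
fun q_seq :: "nat \<Rightarrow> real" where
  "q_seq 0 = 0"
| "q_seq (Suc 0) = 1 / 2"
| "q_seq (Suc (Suc k)) =
     (let t = Suc (Suc k) in (real t - 1) / (2 ^ t - real t - 1) * q_seq (Suc k))"

text \<open>
  Weights \<open>w\<close> live on the positive integers: the series over \<open>t \<ge> 1\<close> are indexed by \<open>Suc k\<close>,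
  and \<open>w 0\<close> never occurs.
\<close>
definition gamma_w :: "(nat \<Rightarrow> real) \<Rightarrow> real" where
  "gamma_w w = (\<Sum>k. w (Suc k) * q_seq (Suc k))"

text \<open>For each \<open>n\<close> only finitely many terms are nonzero, so this series always converges.\<close>
definition F_w :: "(nat \<Rightarrow> real) \<Rightarrow> nat \<Rightarrow> real" where
  "F_w w n = (\<Sum>k. w (Suc k) * c_coeff (Suc k) n)"

lemma summable_F_w: "summable (\<lambda>k. w (Suc k) * c_coeff (Suc k) n)"
proof (rule summable_finite[of "{..n}"])
  fix k assume "k \<notin> {..n}"
  have "length p \<le> sum_list p" if "\<forall>x\<in>set p. x \<ge> 1" for p :: "nat list"
    using that by (induction p) auto
  with \<open>k \<notin> {..n}\<close> have "distinct_parts (Suc k) n = {}"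
    by (force simp: distinct_parts_def)
  then show "w (Suc k) * c_coeff (Suc k) n = 0"
    by (simp add: c_coeff_def)
qed simp

definition S_w :: "(nat \<Rightarrow> real) \<Rightarrow> nat \<Rightarrow> real" where
  "S_w w n = (\<Sum>m=1..<n. F_w w m)"

definition convolution :: "(nat \<Rightarrow> real) \<Rightarrow> (nat \<Rightarrow> real) \<Rightarrow> nat \<Rightarrow> real" where
  "convolution f g n = (\<Sum>m=1..<n. f m * g (n - m))"

end

theory Submission
  imports Defs
begin

text \<open>
  Subtracting \<open>1\<close> from every part of a tuple shows
  \<open>c\<^bsub>t+1\<^esub>(n + t + 1) = (t + 2) c\<^bsub>t+1\<^esub>(n) + t c\<^sub>t(n)\<close>. Hence, by induction on \<open>t\<close>, the quotient
  \<open>c\<^sub>t(n) / 2\<^sup>n\<close> is nondecreasing in \<open>n\<close> and bounded by \<open>q\<^sub>t\<close>; its limit satisfies the same affine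
  equation as \<open>q\<^sub>t\<close>, so it equals \<open>q\<^sub>t\<close>. Comparison with partial sums over \<open>t\<close> transfers this to
  \<open>F\<^sub>w(n) / 2\<^sup>n\<close>, which is again nondecreasing, with limit \<open>\<gamma>\<^sub>w\<close>; the claims about sums and
  convolutions follow by monotonicity.
\<close>

section \<open>Weights of tuples and the recurrence for \<open>c_coeff\<close>\<close>

text \<open>This is the product in \<open>c_coeff\<close>, reindexed from 0 and with
  \<open>t\<close> read off as the length, so that tuples of different lengths can be
  compared.\<close>

definition part_weight :: "nat list \<Rightarrow> real" where
  "part_weight p = (\<Prod>i<length p. ((real i + 2) / (real i + 1)) ^ (p ! i))"

lemma part_weight_nonneg: "part_weight p \<ge> 0"
  unfolding part_weight_def by (intro prod_nonneg) auto

lemma prod_consecutive_ratio: "(\<Prod>i<t. (real i + 2) / (real i + 1)) = real t + 1"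
  by (induction t) (auto simp: field_simps)

text \<open>Raising every exponent by one contributes each base once, and the product of the bases
  telescopes.\<close>

lemma part_weight_map_Suc: "part_weight (map Suc p) = (real (length p) + 1) * part_weight p"
  unfolding part_weight_def length_map prod_consecutive_ratio[of "length p", symmetric] prod.distrib[symmetric]
  by (intro prod.cong) simp_all

lemma part_weight_snoc:
  "part_weight (p @ [x]) =
     part_weight p * ((real (length p) + 2) / (real (length p) + 1)) ^ x"
  by (simp add: part_weight_def nth_append)

lemma c_coeff_part_weight:
  "c_coeff t n = (\<Sum>p\<in>distinct_parts t n. part_weight p) / (real t * (real t + 1))"
proof -
  have "(\<Prod>i=1..t. ((real i + 1) / real i) ^ (p ! (i - 1))) = part_weight p"
    if "p \<in> distinct_parts t n" for p
  proof -
    have "(\<Prod>i=1..t. ((real i + 1) / real i) ^ (p ! (i - 1)))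
        = (\<Prod>i<t. ((real (Suc i) + 1) / real (Suc i)) ^ (p ! (Suc i - 1)))"
      by (simp only: prod.atLeast1_atMost_eq One_nat_def)
    also have "\<dots> = part_weight p"
      using that by (simp add: part_weight_def distinct_parts_def add.commute)
    finally show ?thesis .
  qed
  then show ?thesis
    by (simp add: c_coeff_def sum_divide_distrib)
qed

lemma c_coeff_nonneg: "c_coeff t n \<ge> 0"
  unfolding c_coeff_part_weight by (intro divide_nonneg_nonneg sum_nonneg part_weight_nonneg) auto

lemma distinct_parts_empty:
  assumes "n < t"
  shows "distinct_parts t n = {}"
proof -
  have "length p \<le> sum_list p" if "\<forall>x\<in>set p. x \<ge> 1" for p :: "nat list"
    using that by (induction p) auto
  with assms show ?thesis
    by (force simp: distinct_parts_def)
qed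

lemma c_coeff_eq_0: "n < t \<Longrightarrow> c_coeff t n = 0"
  by (simp add: c_coeff_def distinct_parts_empty)

text \<open>The last part is the smallest. After subtracting 1 everywhere, either all parts stay
  positive, or the last part was 1 and disappears, leaving a tuple of length
  \<open>t\<close>.\<close>

lemma distinct_parts_split:
  "distinct_parts (Suc t) (n + Suc t) =
     map Suc ` distinct_parts (Suc t) n \<union> (\<lambda>p. map Suc p @ [1]) ` distinct_parts t n"
  (is "?L = ?A \<union> ?B")
proof
  show "?A \<union> ?B \<subseteq> ?L"
    by (auto simp: distinct_parts_def sorted_wrt_map sorted_wrt_append sum_list_Suc Suc_le_eq)
  show "?L \<subseteq> ?A \<union> ?B"
  proof
    fix p assume p: "p \<in> ?L"
    then obtain q x where qx: "p = q @ [x]"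
      by (metis (mono_tags, lifting) distinct_parts_def length_Suc_conv_rev mem_Collect_eq)
    have q: "length q = t" "sorted_wrt (>) q" "\<forall>y\<in>set q. y > x" "x \<ge> 1"
      "sum_list q + x = n + Suc t"
      using p by (auto simp: distinct_parts_def qx sorted_wrt_append)
    \<comment> \<open>Entries of \<open>q\<close> exceed \<open>x\<close> \<ge> 1, so the truncated
      subtraction is exact and the entries of \<open>r\<close> are still positive.\<close>
    define r where "r = map (\<lambda>y. y - 1) q"
    have qr: "q = map Suc r"
      using q(3) by (auto simp: r_def intro!: map_idI[symmetric])
    show "p \<in> ?A \<union> ?B"
    proof (cases "x = 1")
      case True
      then have "r \<in> distinct_parts t n"
        using q by (auto simp: distinct_parts_def qr sorted_wrt_map sum_list_Suc)
      with True show ?thesis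
        by (auto simp: qx qr)
    next
      case False
      then obtain y where y: "x = Suc y" "y \<ge> 1"
        using q(4) by (cases x) auto
      have "r @ [y] \<in> distinct_parts (Suc t) n"
        using q y by (auto simp: distinct_parts_def qr sorted_wrt_map sorted_wrt_append sum_list_Suc)
      moreover have "p = map Suc (r @ [y])"
        by (simp add: qx qr y)
      ultimately show ?thesis
        by blast
    qed
  qed
qed

text \<open>Both families gain the same factor: \<open>t + 2\<close> from shifting a tuple of length
  \<open>t + 1\<close>, and \<open>t + 1\<close> from shifting one of length \<open>t\<close>, times
  \<open>(t + 2) / (t + 1)\<close> from the appended 1.\<close>

lemma sum_part_weight_rec:
  "(\<Sum>p\<in>distinct_parts (Suc t) (n + Suc t). part_weight p) =
     (real t + 2) * ((\<Sum>p\<in>distinct_parts (Suc t) n. part_weight p)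
                     + (\<Sum>p\<in>distinct_parts t n. part_weight p))"
proof -
  let ?A = "map Suc ` distinct_parts (Suc t) n"
  let ?B = "(\<lambda>p. map Suc p @ [1]) ` distinct_parts t n"
  \<comment> \<open>The entry 1 separates the two families, since shifted positive entries are at
    least 2.\<close>
  have "1 \<notin> set p" if "p \<in> ?A" for p
    using that by (auto simp: distinct_parts_def)
  moreover have "1 \<in> set p" if "p \<in> ?B" for p
    using that by auto
  ultimately have disj: "?A \<inter> ?B = {}"
    by blast
  have "(\<Sum>p\<in>?A. part_weight p) = (\<Sum>p\<in>distinct_parts (Suc t) n. part_weight (map Suc p))"
    by (simp add: sum.reindex inj_on_def inj_map_eq_map)
  also have "\<dots> = (real t + 2) * (\<Sum>p\<in>distinct_parts (Suc t) n. part_weight p)"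
    unfolding sum_distrib_left
    by (intro sum.cong) (auto simp: part_weight_map_Suc distinct_parts_def)
  finally have A: "(\<Sum>p\<in>?A. part_weight p) = \<dots>" .
  have "(\<Sum>p\<in>?B. part_weight p) = (\<Sum>p\<in>distinct_parts t n. part_weight (map Suc p @ [1]))"
    by (simp add: sum.reindex inj_on_def inj_map_eq_map)
  also have "\<dots> = (real t + 2) * (\<Sum>p\<in>distinct_parts t n. part_weight p)"
    unfolding sum_distrib_left
    by (intro sum.cong) (auto simp: part_weight_map_Suc part_weight_snoc distinct_parts_def)
  finally have B: "(\<Sum>p\<in>?B. part_weight p) = \<dots>" .
  show ?thesis
    unfolding distinct_parts_split distrib_left A[symmetric] B[symmetric]
    by (intro sum.union_disjoint disj finite_imageI finite_distinct_parts)
qed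

lemma c_coeff_rec:
  assumes "t \<ge> 1"
  shows "c_coeff (Suc t) (n + Suc t) = (real t + 2) * c_coeff (Suc t) n + real t * c_coeff t n"
proof -
  define A where "A = (\<Sum>p\<in>distinct_parts (Suc t) n. part_weight p)"
  define B where "B = (\<Sum>p\<in>distinct_parts t n. part_weight p)"
  have "real t > 0" using assms by simp
  then show ?thesis
    unfolding c_coeff_part_weight sum_part_weight_rec A_def[symmetric] B_def[symmetric]
    by (simp add: divide_simps) (simp add: algebra_simps)
qed

lemma c_coeff_1:
  assumes "n \<ge> 1"
  shows "c_coeff (Suc 0) n = 2 ^ n / 2"
proof -
  have "distinct_parts (Suc 0) n = {[n]}"
    using assms by (auto simp: distinct_parts_def length_Suc_conv)
  then show ?thesis
    by (simp add: c_coeff_def)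
qed

section \<open>Normalised coefficients and their limit \<open>q_seq\<close>\<close>

definition c_norm :: "nat \<Rightarrow> nat \<Rightarrow> real" where
  "c_norm t n = c_coeff t n / 2 ^ n"

lemma c_norm_nonneg: "c_norm t n \<ge> 0"
  by (simp add: c_norm_def c_coeff_nonneg)

lemma c_norm_eq_0: "n < t \<Longrightarrow> c_norm t n = 0"
  by (simp add: c_norm_def c_coeff_eq_0)

lemma c_norm_1: "c_norm (Suc 0) n = (if n = 0 then 0 else 1 / 2)"
  by (auto simp: c_norm_def c_coeff_1 c_coeff_eq_0)

lemma c_norm_rec:
  assumes "t \<ge> 1"
  shows "c_norm (Suc t) (n + Suc t) =
           ((real t + 2) * c_norm (Suc t) n + real t * c_norm t n) / 2 ^ Suc t"
  by (simp only: c_norm_def c_coeff_rec[OF assms] power_add times_divide_eq_right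
      add_divide_distrib[symmetric] divide_divide_eq_left)

text \<open>This makes the denominators of \<open>q_seq\<close> positive, and the limit equation of
  \<open>c_norm_rec\<close> uniquely solvable.\<close>

lemma less_power2: "t \<ge> 1 \<Longrightarrow> real t + 2 < 2 ^ Suc t"
proof (induction t rule: dec_induct)
  case (step t)
  have "(1::real) \<le> 2 ^ t" by simp
  with step show ?case by simp
qed simp

text \<open>Clearing the denominator turns the definition into a fixed-point equation of the same
  shape as \<open>c_norm_rec\<close>.\<close>

lemma q_seq_rec:
  assumes "t \<ge> 1"
  shows "q_seq (Suc t) = ((real t + 2) * q_seq (Suc t) + real t * q_seq t) / 2 ^ Suc t"
proof -
  obtain k where k: "t = Suc k" using assms by (cases t) auto
  have "2 ^ Suc t - (real t + 2) > 0" using less_power2[OF assms] by simp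
  moreover have "q_seq (Suc t) = real t / (2 ^ Suc t - (real t + 2)) * q_seq t"
    by (simp add: k Let_def algebra_simps)
  ultimately show ?thesis
    by (simp add: field_simps)
qed

lemma q_seq_nonneg: "q_seq t \<ge> 0"
proof (induction t rule: q_seq.induct)
  case (3 k)
  have "2 ^ Suc (Suc k) - real (Suc (Suc k)) - 1 > 0"
    using less_power2[of "Suc k"] by simp
  with 3 show ?case
    by (simp add: Let_def)
qed auto

text \<open>Induction on \<open>t\<close>, and within it strong induction on \<open>n\<close>: the
  right side of \<open>c_norm_rec\<close> is monotone in both values, and inserting the bounds
  returns \<open>q_seq (Suc t)\<close>.\<close>

lemma c_norm_le_q_seq: "t \<ge> 1 \<Longrightarrow> c_norm t n \<le> q_seq t"
proof (induction t arbitrary: n rule: dec_induct)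
  case base
  show ?case by (simp add: c_norm_1)
next
  case (step t)
  show ?case
  proof (induction n rule: less_induct)
    case (less n)
    show ?case
    proof (cases "n < Suc t")
      case True
      then show ?thesis by (simp add: c_norm_eq_0 q_seq_nonneg del: q_seq.simps)
    next
      case False
      then obtain m where m: "n = m + Suc t"
        by (metis add.commute le_Suc_ex not_less)
      have "c_norm (Suc t) n \<le> ((real t + 2) * q_seq (Suc t) + real t * q_seq t) / 2 ^ Suc t"
        unfolding m c_norm_rec[OF step.hyps(1)]
        by (intro divide_right_mono add_mono mult_left_mono step.IH less.IH) (auto simp: m)
      then show ?thesis
        using q_seq_rec[OF step.hyps(1)] by simp
    qed
  qed
qed

lemma c_norm_le_Suc: "t \<ge> 1 \<Longrightarrow> c_norm t n \<le> c_norm t (Suc n)"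
proof (induction t arbitrary: n rule: dec_induct)
  case base
  show ?case by (simp add: c_norm_1)
next
  case (step t)
  show ?case
  proof (induction n rule: less_induct)
    case (less n)
    show ?case
    proof (cases "n < Suc t")
      case True
      then show ?thesis by (simp add: c_norm_eq_0 c_norm_nonneg)
    next
      case False
      then obtain m where m: "n = m + Suc t"
        by (metis add.commute le_Suc_ex not_less)
      have "c_norm (Suc t) (Suc m + Suc t) \<ge> c_norm (Suc t) (m + Suc t)"
        unfolding c_norm_rec[OF step.hyps(1)]
        by (intro divide_right_mono add_mono mult_left_mono step.IH less.IH) (auto simp: m)
      then show ?thesis
        by (simp add: m)
    qed
  qed
qed

lemma c_norm_tendsto: "t \<ge> 1 \<Longrightarrow> c_norm t \<longlonglongrightarrow> q_seq t"
proof (induction t rule: dec_induct)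
  case base
  have "\<forall>\<^sub>F n in sequentially. c_norm 1 n = q_seq 1"
    using eventually_gt_at_top[of 0] by eventually_elim (simp add: c_norm_1)
  then show ?case
    by (rule tendsto_eventually)
next
  case (step t)
  have "incseq (c_norm (Suc t))"
    by (intro incseq_SucI c_norm_le_Suc) simp
  then obtain l where l: "c_norm (Suc t) \<longlonglongrightarrow> l"
    using incseq_convergent[of "c_norm (Suc t)" "q_seq (Suc t)"] c_norm_le_q_seq[of "Suc t"]
    by (metis le_add1 plus_1_eq_Suc)
  have "(\<lambda>n. c_norm (Suc t) (n + Suc t)) \<longlonglongrightarrow> ((real t + 2) * l + real t * q_seq t) / 2 ^ Suc t"
    unfolding c_norm_rec[OF step.hyps(1)] by (intro tendsto_intros l step.IH) auto
  then have "l = ((real t + 2) * l + real t * q_seq t) / 2 ^ Suc t"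
    using LIMSEQ_ignore_initial_segment[OF l] LIMSEQ_unique by blast
  \<comment> \<open>Both \<open>l\<close> and \<open>q_seq (Suc t)\<close> solve this linear
    equation, whose leading coefficient is positive.\<close>
  then have "(2 ^ Suc t - (real t + 2)) * l = real t * q_seq t"
    by (simp add: field_simps)
  also have "\<dots> = (2 ^ Suc t - (real t + 2)) * q_seq (Suc t)"
    using q_seq_rec[OF step.hyps(1)] by (simp add: field_simps del: q_seq.simps)
  finally have "l = q_seq (Suc t)"
    using less_power2[OF step.hyps(1)] by simp
  with l show ?case by simp
qed

section \<open>Limits of monotone sequences, their sums and convolutions\<close>

text \<open>This replaces an interchange of limits: below a fixed bound \<open>L\<close>, it
  suffices to have eventual minorants whose limits approach \<open>L\<close>.\<close>

lemma tendsto_from_below: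
  fixes f :: "nat \<Rightarrow> real"
  assumes "\<And>n. f n \<le> L"
    and "\<And>K. \<forall>\<^sub>F n in sequentially. g K n \<le> f n"
    and "\<And>K. g K \<longlonglongrightarrow> l K"
    and "l \<longlonglongrightarrow> L"
  shows "f \<longlonglongrightarrow> L"
proof (rule order_tendstoI)
  fix a assume "a < L"
  then obtain K where "a < l K"
    using order_tendstoD(1)[OF assms(4)] eventually_happens'[OF sequentially_bot] by blast
  from order_tendstoD(1)[OF assms(3) this] assms(2)[of K]
  show "\<forall>\<^sub>F n in sequentially. a < f n"
    by eventually_elim simp
next
  fix a assume "L < a"
  then show "\<forall>\<^sub>F n in sequentially. f n < a"
    using assms(1) by (intro always_eventually) (auto intro: le_less_trans)
qed

lemma sum_geometric_weights_tendsto: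
  fixes G :: "nat \<Rightarrow> real"
  assumes "incseq G" "G \<longlonglongrightarrow> L" "G 0 \<ge> 0"
  shows "(\<lambda>n. (\<Sum>m=1..<n. G m * 2 ^ m) / 2 ^ n) \<longlonglongrightarrow> L"
proof -
  \<comment> \<open>The shift makes \<open>G n\<close> the newest term of \<open>T n\<close>. Then
    \<open>T (Suc n)\<close> is the mean of \<open>T n\<close> and \<open>G (Suc n)\<close>, so
    \<open>T\<close> is monotone once \<open>T n\<close> \<le> \<open>G n\<close>, and its limit is
    forced.\<close>
  define T where "T n = (\<Sum>m=1..<Suc n. G m * 2 ^ m) / 2 ^ Suc n" for n
  have T_Suc: "T (Suc n) = (T n + G (Suc n)) / 2" for n
    by (simp add: T_def field_simps)
  have mono: "G n \<le> G (Suc n)" for n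
    using assms(1) by (simp add: incseq_SucD)
  have T_le: "T n \<le> G n" for n
  proof (induction n)
    case 0
    then show ?case using assms(3) by (simp add: T_def)
  next
    case (Suc n)
    then show ?case using mono[of n] by (simp add: T_Suc)
  qed
  have "incseq T"
  proof (rule incseq_SucI)
    show "T n \<le> T (Suc n)" for n
      using T_le[of n] mono[of n] by (simp add: T_Suc)
  qed
  moreover have "T n \<le> L" for n
    using T_le[of n] incseq_le[OF assms(1,2), of n] by simp
  ultimately obtain l where l: "T \<longlonglongrightarrow> l"
    using incseq_convergent[of T L] by metis
  have "(\<lambda>n. T (Suc n)) \<longlonglongrightarrow> (l + L) / 2"
    unfolding T_Suc by (intro tendsto_intros l LIMSEQ_Suc assms(2)) auto
  then have "l = (l + L) / 2"
    using LIMSEQ_Suc[OF l] LIMSEQ_unique by blast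
  with l have "T \<longlonglongrightarrow> L" by simp
  then show ?thesis
    unfolding T_def by (subst (asm) filterlim_sequentially_Suc)
qed

lemma convolution_mean_tendsto:
  fixes G :: "nat \<Rightarrow> real"
  assumes "incseq G" "G \<longlonglongrightarrow> L" "G 0 \<ge> 0"
  shows "(\<lambda>n. convolution G G n / real n) \<longlonglongrightarrow> L\<^sup>2"
proof (rule tendsto_from_below)
  have le_L: "G n \<le> L" for n
    using incseq_le[OF assms(1,2)] .
  have nonneg: "G n \<ge> 0" for n
    using assms(1,3) by (meson incseqD le0 order_trans)
  show "convolution G G n / real n \<le> L\<^sup>2" for n
  proof (cases "n = 0")
    case False
    have "convolution G G n \<le> (\<Sum>m=1..<n. L\<^sup>2)"
      unfolding convolution_def power2_eq_square
      by (intro sum_mono mult_mono le_L nonneg order_trans[OF nonneg le_L])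
    also have "\<dots> \<le> L\<^sup>2 * real n"
      by (simp add: mult.commute mult_right_mono)
    finally show ?thesis
      using False by (simp add: field_simps)
  qed simp
  show "\<forall>\<^sub>F n in sequentially.
          (G (Suc K))\<^sup>2 * (1 - 2 * real (Suc K) / real n) \<le> convolution G G n / real n" for K
    using eventually_gt_at_top[of "2 * Suc K"]
  proof eventually_elim
    case (elim n)
    \<comment> \<open>On this middle range both \<open>m\<close> and \<open>n - m\<close> are at
      least \<open>Suc K\<close>. Using \<open>Suc K\<close> rather than \<open>K\<close> keeps the
      range inside \<open>{1..<n}\<close> also for \<open>K = 0\<close>.\<close>
    let ?M = "{Suc K..<n - Suc K}"
    have "(G (Suc K))\<^sup>2 * (real n - 2 * real (Suc K)) = (\<Sum>m\<in>?M. (G (Suc K))\<^sup>2)"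
      using elim by (simp add: of_nat_diff algebra_simps)
    also have "\<dots> \<le> (\<Sum>m\<in>?M. G m * G (n - m))"
      unfolding power2_eq_square
      by (intro sum_mono mult_mono incseqD[OF assms(1)] nonneg) auto
    also have "\<dots> \<le> convolution G G n"
      unfolding convolution_def
      by (intro sum_mono2) (auto intro: mult_nonneg_nonneg nonneg)
    finally have "(G (Suc K))\<^sup>2 * (real n - 2 * real (Suc K)) / real n \<le> convolution G G n / real n"
      by (intro divide_right_mono) auto
    moreover have "(G (Suc K))\<^sup>2 * (1 - 2 * real (Suc K) / real n)
        = (G (Suc K))\<^sup>2 * (real n - 2 * real (Suc K)) / real n"
      using elim by (simp add: divide_simps)
    ultimately show ?case
      by simp
  qed
  have "(\<lambda>n. 2 * real (Suc K) / real n) \<longlonglongrightarrow> 0" for K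
    by (rule lim_const_over_n)
  from tendsto_mult_left[OF tendsto_diff[OF tendsto_const this]]
  show "(\<lambda>n. (G (Suc K))\<^sup>2 * (1 - 2 * real (Suc K) / real n)) \<longlonglongrightarrow> (G (Suc K))\<^sup>2 * (1 - 0)" for K .
  show "(\<lambda>K. (G (Suc K))\<^sup>2 * (1 - 0)) \<longlonglongrightarrow> L\<^sup>2"
    by (simp, intro tendsto_intros LIMSEQ_Suc assms(2))
qed

text \<open>The factor \<open>x ^ m * x ^ (n - m)\<close> does not depend on \<open>m\<close>, which
  reduces the convolution of \<open>F_w\<close> to that of its normalisation.\<close>

lemma convolution_geometric:
  "convolution (\<lambda>n. f n * x ^ n) (\<lambda>n. g n * x ^ n) n = convolution f g n * x ^ n"
  unfolding convolution_def sum_distrib_right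
proof (rule sum.cong)
  fix m assume "m \<in> {1..<n}"
  then have "x ^ n = x ^ m * x ^ (n - m)"
    by (simp flip: power_add)
  then show "f m * x ^ m * (g (n - m) * x ^ (n - m)) = f m * g (n - m) * x ^ n"
    by simp
qed simp

section \<open>Asymptotics of \<open>F_w\<close>\<close>

lemma F_w_div_power: "F_w w n / 2 ^ n = (\<Sum>k. w (Suc k) * c_norm (Suc k) n)"
  unfolding F_w_def c_norm_def times_divide_eq_right
  by (rule suminf_divide[OF summable_F_w, symmetric])

lemma summable_c_norm: "summable (\<lambda>k. w (Suc k) * c_norm (Suc k) n)"
  unfolding c_norm_def times_divide_eq_right by (rule summable_divide[OF summable_F_w])

lemma incseq_F_w_div_power:
  assumes "\<And>t. t \<ge> 1 \<Longrightarrow> w t \<ge> 0"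
  shows "incseq (\<lambda>n. F_w w n / 2 ^ n)"
proof (rule incseq_SucI)
  fix n
  have "w (Suc k) * c_norm (Suc k) n \<le> w (Suc k) * c_norm (Suc k) (Suc n)" for k
    by (intro mult_left_mono c_norm_le_Suc assms) auto
  then show "F_w w n / 2 ^ n \<le> F_w w (Suc n) / 2 ^ Suc n"
    unfolding F_w_div_power by (rule suminf_le[OF _ summable_c_norm summable_c_norm])
qed

text \<open>A monotone convergence argument: \<open>c_norm_le_q_seq\<close> bounds the series
  termwise, and its partial sums are minorants because all terms are nonnegative.\<close>

lemma F_w_div_power_tendsto:
  assumes "\<And>t. t \<ge> 1 \<Longrightarrow> w t \<ge> 0"
    and "summable (\<lambda>k. w (Suc k) * q_seq (Suc k))"
  shows "(\<lambda>n. F_w w n / 2 ^ n) \<longlonglongrightarrow> gamma_w w"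
  unfolding F_w_div_power gamma_w_def
proof (rule tendsto_from_below[where g = "\<lambda>K n. \<Sum>k<K. w (Suc k) * c_norm (Suc k) n"
      and l = "\<lambda>K. \<Sum>k<K. w (Suc k) * q_seq (Suc k)"])
  show "(\<Sum>k. w (Suc k) * c_norm (Suc k) n) \<le> (\<Sum>k. w (Suc k) * q_seq (Suc k))" for n
    by (intro suminf_le[OF _ summable_c_norm assms(2)] mult_left_mono c_norm_le_q_seq assms(1)) auto
  show "\<forall>\<^sub>F n in sequentially.
      (\<Sum>k<K. w (Suc k) * c_norm (Suc k) n) \<le> (\<Sum>k. w (Suc k) * c_norm (Suc k) n)" for K
    by (intro always_eventually allI sum_le_suminf summable_c_norm ballI mult_nonneg_nonneg
        assms c_norm_nonneg) auto
  show "(\<lambda>n. \<Sum>k<K. w (Suc k) * c_norm (Suc k) n) \<longlonglongrightarrow> (\<Sum>k<K. w (Suc k) * q_seq (Suc k))" for K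
    by (intro tendsto_sum tendsto_mult_left c_norm_tendsto) simp
  show "(\<lambda>K. \<Sum>k<K. w (Suc k) * q_seq (Suc k)) \<longlonglongrightarrow> (\<Sum>k. w (Suc k) * q_seq (Suc k))"
    by (rule summable_LIMSEQ[OF assms(2)])
qed

text \<open>The error is \<open>L - f n / g n\<close>. Starting at \<open>n = 1\<close> admits
  \<open>g n = n * 2 ^ n\<close>, which vanishes at 0.\<close>

lemma little_o_form:
  fixes f g :: "nat \<Rightarrow> real"
  assumes "(\<lambda>n. f n / g n) \<longlonglongrightarrow> L" and "\<And>n. n \<ge> 1 \<Longrightarrow> g n \<noteq> 0"
  shows "\<exists>e. e \<longlonglongrightarrow> 0 \<and> (\<forall>n\<ge>1. f n = (L - e n) * g n)"
proof (intro exI conjI)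
  show "(\<lambda>n. L - f n / g n) \<longlonglongrightarrow> 0"
    using tendsto_diff[OF tendsto_const assms(1), of L] by simp
qed (use assms(2) in simp)

theorem theorem2p7:
  fixes w :: "nat \<Rightarrow> real"
  assumes "\<And>t. t \<ge> 1 \<Longrightarrow> w t \<ge> 0"
    and "summable (\<lambda>k. w (Suc k) * q_seq (Suc k))"
  shows "(\<exists>e :: nat \<Rightarrow> real. e \<longlonglongrightarrow> 0 \<and>
            (\<forall>n\<ge>1. F_w w n = (gamma_w w - e n) * 2 ^ n))
       \<and> (\<exists>e :: nat \<Rightarrow> real. e \<longlonglongrightarrow> 0 \<and>
            (\<forall>n\<ge>1. S_w w n = (gamma_w w - e n) * 2 ^ n))
       \<and> (\<exists>e :: nat \<Rightarrow> real. e \<longlonglongrightarrow> 0 \<and>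
            (\<forall>n\<ge>1. convolution (F_w w) (F_w w) n = ((gamma_w w)\<^sup>2 - e n) * real n * 2 ^ n))"
proof -
  define G where "G n = F_w w n / 2 ^ n" for n
  have F: "F_w w = (\<lambda>n. G n * 2 ^ n)"
    by (simp add: G_def)
  have inc: "incseq G"
    using incseq_F_w_div_power[of w] assms(1) by (simp add: G_def[abs_def])
  have lim: "G \<longlonglongrightarrow> gamma_w w"
    using F_w_div_power_tendsto[of w] assms by (simp add: G_def[abs_def])
  have G0: "G 0 \<ge> 0"
    by (simp add: G_def F_w_def c_coeff_eq_0)
  have 1: "(\<lambda>n. F_w w n / 2 ^ n) \<longlonglongrightarrow> gamma_w w"
    using lim by (simp add: F)
  have 2: "(\<lambda>n. S_w w n / 2 ^ n) \<longlonglongrightarrow> gamma_w w"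
    using sum_geometric_weights_tendsto[OF inc lim G0] by (simp add: S_w_def F)
  have 3: "(\<lambda>n. convolution (F_w w) (F_w w) n / (real n * 2 ^ n)) \<longlonglongrightarrow> (gamma_w w)\<^sup>2"
    using convolution_mean_tendsto[OF inc lim G0] by (simp add: F convolution_geometric)
  show ?thesis
    using little_o_form[OF 1] little_o_form[OF 2] little_o_form[OF 3] by (simp add: mult.assoc)
qed

end
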